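(* Let $p\in[0,1/2)$ and suppose the true position $L^*$ is uniformly distributed on $[n]$. For any variable-length noisy searching scheme with error probability $\tilde P_e=\mathbb{P}(\hat L\ne L^* )$, the expected number of queries satisfies $$\mathbb{E}[\tilde M]>\frac{\log_2 n}{1-H(p)}+\frac{\log_2\frac{1}{\tilde P_e}}{D(p\|1-p)}-\frac{\log_2\log_2\frac{n}{\tilde P_e}}{D(p\|1-p)}-\frac{\tilde P_e\log_2 n}{1-H(p)}+O(1).$$
   Context: Noisy searching problem: given sorted reals $\tilde\theta_0=-\infty<\tilde\theta_1<\cdots<\tilde\theta_{n-1}<\tilde\theta_n=+\infty$ and a target $\tilde\theta$, the true position is the index $l^*\in[n]$ with $\tilde\theta_{l^*-1}<\tilde\theta<\tilde\theta_{l^*}$. At step $k$ the agent queries $\tilde U_k\in\{\tilde\theta_1,\ldots,\tilde\theta_{n-1}\}$ and receives $\tilde Y_k=\mathbb{1}_{\{\tilde U_k<\tilde\theta\}}\oplus\tilde Z_k$, with $\tilde Z_k$ i.i.d. $\mathrm{Bern}(p)$. A variable-length noisy searching scheme consists of a causal adaptive querying strategy $\tilde U_k=\tilde f_k(\tilde Y^{k-1},\tilde U^{k-1})$, a stopping time $\tilde M$ (number of queries, possibly depending on responses), and an estimator $\hat L=\hat l(\tilde Y^{\tilde M},\tilde U^{\tilde M})$. $H(p)=-p\log_2p-(1-p)\log_2(1-p)$, $D(p\|1-p)=p\log_2\frac{p}{1-p}+(1-p)\log_2\frac{1-p}{p}$. $O(1)$ denotes a term bounded by a constant not depending on $n$ or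 $\tilde P_e$. *)

theory Defs
  imports "HOL-Probability.Probability"
begin

definition H2 :: "real \<Rightarrow> real" where
  "H2 p = - p * log 2 p - (1 - p) * log 2 (1 - p)"

definition Dkl :: "real \<Rightarrow> real" where
  "Dkl p = p * log 2 (p / (1 - p)) + (1 - p) * log 2 ((1 - p) / p)"

text \<open>A query strategy f k ys us gives the index j of the (k+1)-th query theta_j, from the
  past responses ys and past queries us. The true position is l, the noise sequence is z
  (z k = Z_{k+1}). The response to query theta_u is 1{theta_u < theta} XOR Z, and
  theta_u < theta iff u < l. hist returns (responses, queries) after k queries.\<close>
fun hist :: "(nat \<Rightarrow> bool list \<Rightarrow> nat list \<Rightarrow> nat) \<Rightarrow> nat \<Rightarrow> (nat \<Rightarrow> bool) \<Rightarrow> nat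
    \<Rightarrow> bool list \<times> nat list" where
  "hist f l z 0 = ([], [])"
| "hist f l z (Suc k) =
     (let (ys, us) = hist f l z k; u = f k ys us in (ys @ [(u < l) \<noteq> z k], us @ [u]))"

definition stop_time :: "(nat \<Rightarrow> bool list \<Rightarrow> nat list \<Rightarrow> nat) \<Rightarrow> (bool list \<Rightarrow> nat list \<Rightarrow> bool)
    \<Rightarrow> nat \<Rightarrow> (nat \<Rightarrow> bool) \<Rightarrow> enat" where
  "stop_time f stop l z =
     (if \<exists>k. case_prod stop (hist f l z k)
      then enat (LEAST k. case_prod stop (hist f l z k)) else \<infinity>)"

definition search_space :: "nat \<Rightarrow> real \<Rightarrow> (nat \<times> (nat \<Rightarrow> bool)) measure" where
  "search_space n p = measure_pmf (pmf_of_set {1..n}) \<Otimes>\<^sub>M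
     (\<Pi>\<^sub>M k\<in>(UNIV::nat set). measure_pmf (bernoulli_pmf p))"

definition err_prob :: "(nat \<Rightarrow> bool list \<Rightarrow> nat list \<Rightarrow> nat) \<Rightarrow> (bool list \<Rightarrow> nat list \<Rightarrow> bool)
    \<Rightarrow> (bool list \<Rightarrow> nat list \<Rightarrow> nat) \<Rightarrow> nat \<Rightarrow> real \<Rightarrow> real" where
  "err_prob f stop est n p = measure (search_space n p)
     {\<omega> \<in> space (search_space n p).
        (case stop_time f stop (fst \<omega>) (snd \<omega>) of
           \<infinity> \<Rightarrow> True
         | enat m \<Rightarrow> case_prod est (hist f (fst \<omega>) (snd \<omega>) m) \<noteq> fst \<omega>)}"

definition exp_queries :: "(nat \<Rightarrow> bool list \<Rightarrow> nat list \<Rightarrow> nat) \<Rightarrow> (bool list \<Rightarrow> nat list \<Rightarrow> bool)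
    \<Rightarrow> nat \<Rightarrow> real \<Rightarrow> ennreal" where
  "exp_queries f stop n p =
     (\<integral>\<^sup>+ \<omega>. ennreal_of_enat (stop_time f stop (fst \<omega>) (snd \<omega>)) \<partial>search_space n p)"

end

theory Submission
  imports Defs
begin

text \<open>Truncate the scheme at a large depth N, so that it becomes a finite decision tree, and attach
  to each node the unnormalised posterior w, of total mass s. Two functionals of w are followed.
  The entropy H loses on average at most 1 - H(p) per query. The posterior log-odds
  U = sum of w(l) log((s - w(l)) / w(l)) loses at most D = D(p||1-p), because its expected drop is
  an average of divergences between the response law under l and the mixture of the response laws
  of the other positions, and every such law lies between Bern(p) and Bern(1-p). The potential is
  H / (1 - H(p)) until some position carries all but a fraction 1 / (2 log n) of the mass, and
  U / D plus a constant afterwards. At the switch H is bounded while U is at least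
  -log log n - O(1), and this is the cost of the log log term. At a leaf with error mass e, both
  potentials are bounded by a multiple of e plus a multiple of s, the logarithm log(e/s) being
  replaced by its tangent at the error probability. Telescoping over the tree gives the bound.
  For p = 0 the entropy alone suffices.\<close>

subsection \<open>Logarithmic inequalities\<close>

text \<open>The tangent bound \<open>ln y \<le> y - 1\<close> at \<open>y = c / x\<close>,
  multiplied by \<open>x\<close>; it survives at \<open>x = 0\<close> because the left side vanishes
  there. The point \<open>c\<close> is chosen according to need: half of the mass, an equal share,
  or the error mass over \<open>t\<close>.\<close>

lemma mult_log_le:
  assumes "0 \<le> x" "0 < c"
  shows "x * (log 2 c - log 2 x) \<le> (c - x) / ln (2::real)"
proof (cases "x = 0")
  case False
  then have x: "x > 0" using assms by simp
  have "ln (c / x) \<le> c / x - 1" using x assms by (intro ln_le_minus_one) simp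
  then have "x * ln (c / x) \<le> x * (c / x - 1)" using x by simp
  also have "\<dots> = c - x" using x by (simp add: field_simps)
  finally have "x * ln (c / x) / ln 2 \<le> (c - x) / ln 2"
    by (intro divide_right_mono) auto
  moreover have "log 2 c - log 2 x = ln (c / x) / ln 2"
    using x assms by (simp add: log_def ln_div diff_divide_distrib)
  ultimately show ?thesis by simp
qed (use assms in simp)

text \<open>Gibbs' inequality for Bern(p) against the fair coin; it makes the capacity
  \<open>1 - H2 p\<close> positive.\<close>

lemma H2_less_1:
  assumes "0 \<le> p" "p < 1/2"
  shows "H2 p < 1"
proof -
  have a: "p * (log 2 (1/2) - log 2 p) \<le> (1/2 - p) / ln 2"
    using assms by (intro mult_log_le) auto
  \<comment> \<open>Strictness is drawn from the weight \<open>1 - p\<close> alone, since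
    \<open>p\<close> may be 0; equality in \<open>ln y \<le> y - 1\<close> would force
    \<open>1 - p = 1/2\<close>.\<close>
  have n: "ln (1/2 / (1-p)) < 1/2 / (1-p) - 1"
    using assms ln_eq_minus_one[of "1/2 / (1-p)"] ln_le_minus_one[of "1/2 / (1-p)"]
    by (force simp: field_simps)
  then have "(1-p) * ln (1/2 / (1-p)) < (1-p) * (1/2 / (1-p) - 1)"
    using assms by simp
  also have "\<dots> = 1/2 - (1 - p)" using assms by (simp add: field_simps)
  finally have "(1-p) * ln (1/2 / (1-p)) / ln 2 < (1/2 - (1-p)) / ln 2"
    by (intro divide_strict_right_mono) auto
  moreover have "log 2 (1/2) - log 2 (1-p) = ln (1/2 / (1-p)) / ln 2"
  proof -
    have "ln (1/2 / (1-p)) = ln (1/2) - ln (1-p)" using assms ln_div[of "1/2" "1-p"] by simp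
    then show ?thesis by (simp add: log_def diff_divide_distrib)
  qed
  ultimately have "(1-p) * (log 2 (1/2) - log 2 (1-p)) < (1/2 - (1-p)) / ln 2"
    by simp
  with a have "p * (log 2 (1/2) - log 2 p) + (1-p) * (log 2 (1/2) - log 2 (1-p)) < (1/2 - p) / ln 2 + (1/2 - (1-p)) / ln 2"
    by linarith
  also have "\<dots> = 0" by (simp add: field_simps)
  finally show ?thesis
    by (simp add: H2_def log_divide algebra_simps)
qed

text \<open>The difference \<open>Dkl p - (1 - H2 p)\<close> equals
  \<open>- p * log 2 (2 * (1-p)) - (1-p) * log 2 (2 * p)\<close>, and the tangent bound shows this
  to be at least \<open>(1 - 2 * p)^2 / ln 2\<close>. At leaves it lets the entropy coefficient
  \<open>1 / (1 - H2 p)\<close> dominate \<open>1 / Dkl p\<close>; it also gives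
  \<open>Dkl p > 0\<close>.\<close>

lemma capacity_le_Dkl:
  assumes "0 < p" "p < 1/2"
  shows "1 - H2 p \<le> Dkl p"
proof -
  have e: "p * (1-p) \<le> 1/4" using zero_le_square[of "2*p-1"] by (simp add: algebra_simps power2_eq_square)
  have a: "p * (log 2 (1/2) - log 2 p) \<le> (1/2 - p) / ln 2"
    using assms by (intro mult_log_le) auto
  have "ln (2 * (1-p)) \<le> 2 * (1-p) - 1" "ln (2 * p) \<le> 2*p - 1"
    by (rule ln_le_minus_one, use assms in simp)+
  then have "p * ln (2 * (1-p)) + (1-p) * ln (2 * p) \<le> p * (2 * (1-p) - 1) + (1-p) * (2*p - 1)"
    using assms by (intro add_mono mult_left_mono) auto
  also have "\<dots> \<le> 0" using e by (simp add: algebra_simps)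
  finally have "(p * ln (2 * (1-p)) + (1-p) * ln (2 * p)) / ln 2 \<le> 0" 
    by (simp add: divide_nonpos_pos)
  then have "p * log 2 (2 * (1-p)) + (1-p) * log 2 (2 * p) \<le> 0"
    by (simp add: log_def add_divide_distrib)
  then show ?thesis
    using assms by (simp only: H2_def Dkl_def log_divide log_mult) (simp add: algebra_simps)
qed

text \<open>The left side is the divergence of Bern(1-p) from Bern(r), and \<open>r = p\<close> is
  the worst case: by the tangent bound, passing from \<open>p\<close> to \<open>r\<close> adds at
  most a multiple of \<open>p * (1-p) / (r * (1-r)) - 1\<close>, which is nonpositive on this
  interval.\<close>

lemma binary_divergence_le_Dkl:
  assumes "0 < p" "p < 1/2" "p \<le> r" "r \<le> 1 - p"
  shows "(1-p) * (log 2 (1-p) - log 2 r) + p * (log 2 p - log 2 (1-r)) \<le> Dkl p"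
proof -
  have r: "0 < r" "r < 1" using assms by auto
  have *: "r * (1-r) - p * (1-p) = (r - p) * (1 - p - r)" by (simp add: algebra_simps)
  have "p * (1-p) \<le> r * (1-r)" 
    using mult_nonneg_nonneg[of "r-p" "1-p-r"] assms * by linarith
  then have "p * (1-p) / (r * (1-r)) \<le> 1" using r by (simp add: field_simps)
  moreover have "(1-p) * (p / r - 1) + p * ((1-p)/(1-r) - 1) = p * (1-p) / (r * (1-r)) - 1"
    using r by (simp add: field_simps)
  moreover have "ln (p / r) \<le> p / r - 1" "ln ((1-p)/(1-r)) \<le> (1-p)/(1-r) - 1"
    using assms r by (auto intro!: ln_le_minus_one)
  then have "(1-p) * ln (p / r) + p * ln ((1-p)/(1-r)) \<le> (1-p) * (p / r - 1) + p * ((1-p)/(1-r) - 1)"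
    using assms by (intro add_mono mult_left_mono) auto
  ultimately have "(1-p) * ln (p / r) + p * ln ((1-p)/(1-r)) \<le> 0" by linarith
  then have "((1-p) * ln (p / r) + p * ln ((1-p)/(1-r))) / ln 2 \<le> 0" 
    by (simp add: divide_nonpos_pos)
  then have "(1-p) * log 2 (p / r) + p * log 2 ((1-p)/(1-r)) \<le> 0"
    by (simp add: log_def add_divide_distrib)
  then show ?thesis using assms r by (simp add: Dkl_def log_divide algebra_simps)
qed

subsection \<open>Entropy and log-odds of an unnormalised posterior\<close>

definition lik :: "real \<Rightarrow> nat \<Rightarrow> bool \<Rightarrow> nat \<Rightarrow> real" where
  "lik p u y l = (if y = (u < l) then 1 - p else p)"

text \<open>Bayes' rule without normalisation. Started from the prior, the total weight at a node is
  the probability of its response sequence, so averages over responses become plain sums over the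
  two children.\<close>

definition update :: "real \<Rightarrow> nat \<Rightarrow> bool \<Rightarrow> (nat \<Rightarrow> real) \<Rightarrow> nat \<Rightarrow> real" where
  "update p u y w l = w l * lik p u y l"

definition entropy_pot :: "nat set \<Rightarrow> (nat \<Rightarrow> real) \<Rightarrow> real" where
  "entropy_pot I w = (\<Sum>l\<in>I. w l * (log 2 (sum w I) - log 2 (w l)))"

definition log_odds_pot :: "nat set \<Rightarrow> (nat \<Rightarrow> real) \<Rightarrow> real" where
  "log_odds_pot I w = (\<Sum>l\<in>I. w l * (log 2 (sum w I - w l) - log 2 (w l)))"

section \<open>Loss of the two potentials in one query\<close>

lemma lik_add: "lik p u False l + lik p u True l = 1"
  by (simp add: lik_def)

lemma sum_update_add: "sum (update p u False w) I + sum (update p u True w) I = sum w I"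
  by (simp add: update_def sum.distrib[symmetric] distrib_left[symmetric] lik_add)

text \<open>Chain rule: the drop is the mutual information of position and response, that is, the
  response entropy minus the noise entropy \<open>H2 p\<close>, scaled by the mass.\<close>

lemma entropy_pot_step:
  assumes I: "finite I" and w: "\<And>l. l \<in> I \<Longrightarrow> 0 \<le> w l" and p: "0 \<le> p" "p < 1/2"
  shows "entropy_pot I w \<le> (1 - H2 p) * sum w I
    + entropy_pot I (update p u False w) + entropy_pot I (update p u True w)"
proof -
  define s a b where "s = sum w I" and "a = sum (update p u False w) I" and "b = sum (update p u True w) I"
  have ab: "a + b = s" unfolding a_def b_def s_def by (rule sum_update_add)
  have nn: "0 \<le> a" "0 \<le> b" 
    unfolding a_def b_def by (auto intro!: sum_nonneg mult_nonneg_nonneg w simp: update_def lik_def p) (use p in auto)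
  have e: "x * q * log 2 (x * q) = q * (x * log 2 x) + x * (q * log 2 q)" if "x \<ge> 0" "q \<ge> 0" for x q :: real
    using that by (cases "x = 0 \<or> q = 0") (auto simp: log_mult algebra_simps)
  have 1: "entropy_pot I v = sum v I * log 2 (sum v I) - (\<Sum>l\<in>I. v l * log 2 (v l))" for v
    by (simp add: entropy_pot_def right_diff_distrib sum_subtractf sum_distrib_right)
  have "(\<Sum>l\<in>I. update p u False w l * log 2 (update p u False w l)) + (\<Sum>l\<in>I. update p u True w l * log 2 (update p u True w l))
     = (\<Sum>l\<in>I. w l * log 2 (w l) - w l * H2 p)"
    unfolding sum.distrib[symmetric]
  proof (rule sum.cong[OF refl])
    fix l assume l: "l \<in> I"
    show "update p u False w l * log 2 (update p u False w l) + update p u True w l * log 2 (update p u True w l)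
     = w l * log 2 (w l) - w l * H2 p"
      unfolding update_def lik_def H2_def using w[OF l] p by (simp add: e) (simp add: algebra_simps)
  qed
  then have 2: "(\<Sum>l\<in>I. update p u False w l * log 2 (update p u False w l)) + (\<Sum>l\<in>I. update p u True w l * log 2 (update p u True w l))
     = (\<Sum>l\<in>I. w l * log 2 (w l)) - s * H2 p"
    by (simp add: sum_subtractf sum_distrib_right s_def)
  \<comment> \<open>A binary response carries at most one bit: both tangents are taken at half of
    the mass, and their linear parts cancel.\<close>
  have 3: "s * log 2 s \<le> s + a * log 2 a + b * log 2 b"
  proof (cases "s = 0")
    case True
    then have "a = 0" "b = 0" using ab nn by linarith+
    then show ?thesis using True by simp
  next
    case False
    then have s: "s > 0" using ab nn by simp
    have "a * (log 2 (s/2) - log 2 a) + b * (log 2 (s/2) - log 2 b) \<le> (s/2 - a) / ln 2 + (s/2 - b) / ln 2"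
      using s nn by (intro add_mono mult_log_le) auto
    also have "\<dots> = (s - (a + b)) / ln 2" by (simp add: field_simps)
    also have "\<dots> = 0" using ab by simp
    finally have "(a + b) * (log 2 s - 1) \<le> a * log 2 a + b * log 2 b"
      using s by (simp add: log_divide algebra_simps)
    then show ?thesis unfolding ab by (simp add: algebra_simps)
  qed
  show ?thesis using 2 3 unfolding 1 s_def[symmetric] a_def[symmetric] b_def[symmetric] 
    by (simp add: algebra_simps)
qed

text \<open>The bound holds position by position: the term of \<open>l\<close> loses
  \<open>w l\<close> times the divergence of the response law under \<open>l\<close> from that under
  the mixture of its competitors.\<close>

lemma log_odds_pot_step:
  assumes I: "finite I" "card I \<ge> 2" and w: "\<And>l. l \<in> I \<Longrightarrow> 0 < w l" and p: "0 < p" "p < 1/2"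
  shows "log_odds_pot I w \<le> Dkl p * sum w I
    + log_odds_pot I (update p u False w) + log_odds_pot I (update p u True w)"
proof -
  have "w l * (log 2 (sum w I - w l) - log 2 (w l)) \<le> Dkl p * w l +
    (update p u False w l * (log 2 (sum (update p u False w) I - update p u False w l) - log 2 (update p u False w l)) +
     update p u True w l * (log 2 (sum (update p u True w) I - update p u True w l) - log 2 (update p u True w l)))" 
    if l: "l \<in> I" for l
  proof -
    define R where "R y = sum (update p u y w) (I - {l})" for y
    define R0 where "R0 = sum w (I - {l})"
    have sub: "sum v I - v l = sum v (I - {l})" for v :: "nat \<Rightarrow> real"
      using l I by (simp add: sum_diff1)
    have "card (I - {l}) \<ge> 1" using l I by simp
    then have ne: "I - {l} \<noteq> {}" by (metis card.empty not_one_le_zero)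
    have R0: "R0 > 0" unfolding R0_def using I ne w by (intro sum_pos) auto
    have RR: "R False + R True = R0" unfolding R_def R0_def by (rule sum_update_add)
    \<comment> \<open>Every likelihood is at least \<open>p\<close>, so either response keeps at
      least a fraction \<open>p\<close> of the competing mass; this places \<open>r\<close> between
      \<open>p\<close> and \<open>1 - p\<close>.\<close>
    have Rge: "p * R0 \<le> R y" for y unfolding R_def R0_def sum_distrib_left
    proof (rule sum_mono)
      fix i assume "i \<in> I - {l}"
      then have "w i > 0" using w by simp
      moreover have "p \<le> lik p u y i" using p by (simp add: lik_def)
      ultimately show "p * w i \<le> update p u y w i" by (simp add: update_def mult.commute)
    qed
    \<comment> \<open>\<open>y\<close> is the noiseless answer for \<open>l\<close>, so under
      \<open>l\<close> it has probability \<open>1 - p\<close>; below, \<open>r\<close> is its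
      probability under the mixture of the competitors.\<close>
    define y where "y = (u < l)"
    have yy: "R y + R (\<not> y) = R0" using RR by (cases y) auto
    have pos: "R y > 0" "R (\<not> y) > 0" using Rge[of y] Rge[of "\<not> y"] R0 p
      by (smt (verit) mult_pos_pos)+
    define r where "r = R y / R0"
    have r1: "1 - r = R (\<not> y) / R0" using yy R0 by (simp add: r_def field_simps)
    have "p \<le> r" "p \<le> 1 - r" unfolding r1 using R0 Rge by (auto simp: r_def field_simps)
    then have "(1-p) * (log 2 (1-p) - log 2 r) + p * (log 2 p - log 2 (1-r)) \<le> Dkl p"
      using p by (intro binary_divergence_le_Dkl) auto
    then have d: "(1-p) * (log 2 (1-p) - (log 2 (R y) - log 2 R0)) + p * (log 2 p - (log 2 (R (\<not> y)) - log 2 R0)) \<le> Dkl p"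
      unfolding r1 using pos R0 by (simp add: r_def log_divide)
    have wl: "w l > 0" using w l by simp
    have "log 2 R0 - log 2 (w l) \<le> Dkl p + (1-p) * (log 2 (R y) - (log 2 (w l) + log 2 (1-p)))
        + p * (log 2 (R (\<not> y)) - (log 2 (w l) + log 2 p))"
      using d by (simp add: algebra_simps)
    from mult_left_mono[OF this, of "w l"] wl
    have "w l * (log 2 R0 - log 2 (w l)) \<le> Dkl p * w l + (w l * (1-p) * (log 2 (R y) - (log 2 (w l) + log 2 (1-p)))
        + w l * p * (log 2 (R (\<not> y)) - (log 2 (w l) + log 2 p)))"
      by (simp add: algebra_simps)
    then show ?thesis unfolding sub R_def[symmetric] R0_def[symmetric]
      using p wl by (cases y) (simp_all add: update_def lik_def y_def log_mult)
  qed
  then have "log_odds_pot I w \<le> (\<Sum>l\<in>I. Dkl p * w l +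
    (update p u False w l * (log 2 (sum (update p u False w) I - update p u False w l) - log 2 (update p u False w l)) +
     update p u True w l * (log 2 (sum (update p u True w) I - update p u True w l) - log 2 (update p u True w l))))"
    unfolding log_odds_pot_def by (rule sum_mono)
  then show ?thesis
    unfolding log_odds_pot_def by (simp add: sum.distrib sum_distrib_left)
qed

section \<open>Bounds for the potentials at leaves and at the switch\<close>

lemma rest_entropy_le:
  fixes w :: "nat \<Rightarrow> real"
  assumes I: "finite I" "j \<in> I" and w: "\<And>l. l \<in> I \<Longrightarrow> 0 \<le> w l"
  shows "(\<Sum>l\<in>I - {j}. w l * (log 2 (sum w I) - log 2 (w l)))
    \<le> (sum w I - w j) * log 2 (card I) + (w j - sum w I / card I) / ln 2"
proof (cases "sum w I = 0")
  case True
  then have "w l = 0" if "l \<in> I" for l using that sum_nonneg_eq_0_iff[of I w] I w by auto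
  then show ?thesis using True I by simp
next
  case False
  define s where "s = sum w I"
  have s: "s > 0" using False sum_nonneg[of I w] w unfolding s_def by force
  have c: "card I > 0" using I by (auto simp: card_gt_0_iff)
  have d: "sum v I - v j = sum v (I - {j})" for v :: "nat \<Rightarrow> real"
    using I by (simp add: sum_diff1)
  \<comment> \<open>Gibbs' inequality against the uniform law. Position \<open>j\<close> is left out
    because the two potentials need different bounds for its term.\<close>
  have "(\<Sum>l\<in>I - {j}. w l * (log 2 s - log 2 (w l))) \<le>
     (\<Sum>l\<in>I - {j}. w l * log 2 (card I) + (s / card I - w l) / ln 2)"
  proof (rule sum_mono)
    fix l assume "l \<in> I - {j}"
    then have "w l * (log 2 (s / card I) - log 2 (w l)) \<le> (s / card I - w l) / ln 2"
      using s c w by (intro mult_log_le) auto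
    then show "w l * (log 2 s - log 2 (w l)) \<le> w l * log 2 (card I) + (s / card I - w l) / ln 2"
      using s c by (simp add: log_divide algebra_simps)
  qed
  also have "\<dots> = (\<Sum>l\<in>I - {j}. w l) * log 2 (card I) + (\<Sum>l\<in>I - {j}. s / card I - w l) / ln 2"
    by (simp add: sum.distrib sum_distrib_right sum_divide_distrib)
  also have "(\<Sum>l\<in>I - {j}. s / card I - w l) = w j - s / card I"
    using c by (subst d[symmetric]) (simp add: sum_subtractf s_def)
  finally show ?thesis using d[of w] by (simp add: s_def)
qed

text \<open>A Fano-type inequality for the guess \<open>j\<close>, linear in the error mass. The
  tangent at the total mass controls the term of \<open>j\<close>, and
  \<open>rest_entropy_le\<close> the others.\<close>

lemma entropy_pot_le:
  assumes I: "finite I" "j \<in> I" and w: "\<And>l. l \<in> I \<Longrightarrow> 0 \<le> w l"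
  shows "entropy_pot I w \<le> (sum w I - w j) * log 2 (card I) + sum w I / ln 2"
proof (cases "sum w I = 0")
  case True
  then have "w l = 0" if "l \<in> I" for l using that sum_nonneg_eq_0_iff[of I w] I w by auto
  then show ?thesis using True I by (simp add: entropy_pot_def)
next
  case False
  have s: "sum w I > 0" using False sum_nonneg[of I w] w by force
  have "entropy_pot I w = w j * (log 2 (sum w I) - log 2 (w j)) + (\<Sum>l\<in>I - {j}. w l * (log 2 (sum w I) - log 2 (w l)))"
    unfolding entropy_pot_def using I by (rule sum.remove)
  also have "\<dots> \<le> (sum w I - w j) / ln 2 + ((sum w I - w j) * log 2 (card I) + (w j - sum w I / card I) / ln 2)"
    using I w s by (intro add_mono mult_log_le rest_entropy_le) auto
  also have "\<dots> = (sum w I - w j) * log 2 (card I) + sum w I / ln 2 - sum w I / card I / ln 2"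
    by (simp add: diff_divide_distrib)
  finally show ?thesis using s by (smt (verit) divide_nonneg_nonneg ln_ge_zero of_nat_0_le_iff)
qed

text \<open>Only the average error over leaves is known, so the bound has to be linear in the error
  mass \<open>e = sum w I - w j\<close>. The term of \<open>j\<close> contains
  \<open>w j * log 2 e\<close>, whose tangent at \<open>e = t * w j\<close> yields
  \<open>log 2 t\<close>; the other terms are at most entropy terms, left to
  \<open>rest_entropy_le\<close>.\<close>

lemma log_odds_pot_le:
  assumes I: "finite I" "card I \<ge> 2" "j \<in> I" and w: "\<And>l. l \<in> I \<Longrightarrow> 0 < w l" and t: "0 < t"
  shows "log_odds_pot I w \<le> (sum w I - w j) * (log 2 (card I) + 1 / (t * ln 2) - log 2 t)
    + sum w I * (1 / ln 2 + log 2 t)"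
proof -
  define s where "s = sum w I"
  have less: "w l < s" if "l \<in> I" for l
  proof -
    have "card (I - {l}) \<ge> 1" using that I by simp
    then have "I - {l} \<noteq> {}" by (metis card.empty not_one_le_zero)
    then have "0 < sum w (I - {l})" using I w by (intro sum_pos) auto
    then show ?thesis using that I by (simp add: sum_diff1 s_def)
  qed
  have s: "s > 0" using less[OF I(3)] w[OF I(3)] by simp
  have "w j * (log 2 ((s - w j) / t) - log 2 (w j)) \<le> ((s - w j) / t - w j) / ln 2"
    using less[OF I(3)] w[OF I(3)] t by (intro mult_log_le) auto
  then have 1: "w j * (log 2 (s - w j) - log 2 (w j)) \<le> ((s - w j) / t - w j) / ln 2 + w j * log 2 t"
    using less[OF I(3)] t by (simp add: log_divide algebra_simps)
  have 2: "(\<Sum>l\<in>I - {j}. w l * (log 2 (s - w l) - log 2 (w l))) \<le> (\<Sum>l\<in>I - {j}. w l * (log 2 s - log 2 (w l)))"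
  proof (intro sum_mono mult_left_mono diff_right_mono)
    fix l assume "l \<in> I - {j}"
    then show "log 2 (s - w l) \<le> log 2 s" "0 \<le> w l"
      using less[of l] w[of l] s by (auto simp: less_imp_le)
  qed
  have 3: "\<dots> \<le> (s - w j) * log 2 (card I) + (w j - s / card I) / ln 2"
    unfolding s_def using I w by (intro rest_entropy_le) (auto simp: less_imp_le)
  have "log_odds_pot I w = w j * (log 2 (s - w j) - log 2 (w j)) + (\<Sum>l\<in>I - {j}. w l * (log 2 (s - w l) - log 2 (w l)))"
    unfolding log_odds_pot_def s_def using I(1,3) by (rule sum.remove)
  also have "\<dots> \<le> ((s - w j) / t - w j) / ln 2 + w j * log 2 t + ((s - w j) * log 2 (card I) + (w j - s / card I) / ln 2)"
    using 1 2 3 by linarith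
  also have "\<dots> = (s - w j) * (log 2 (card I) + 1 / (t * ln 2) - log 2 t) + s * log 2 t - s / card I / ln 2"
    by (simp add: diff_divide_distrib add_divide_distrib algebra_simps)
  also have "\<dots> \<le> (s - w j) * (log 2 (card I) + 1 / (t * ln 2) - log 2 t) + s * (1 / ln 2 + log 2 t)"
  proof -
    have "0 \<le> s / card I / ln 2" "0 \<le> s / ln 2" using s by simp_all
    then show ?thesis by (simp add: algebra_simps)
  qed
  finally show ?thesis unfolding s_def .
qed

text \<open>With at least half of the mass on \<open>m\<close>, every other position has the odds
  against it and hence a nonnegative term. Only the term of \<open>m\<close> can be negative, and
  the lower bound on the mass outside \<open>m\<close> controls it.\<close>

lemma log_odds_pot_ge:
  assumes I: "finite I" "card I \<ge> 2" "m \<in> I" and w: "\<And>l. l \<in> I \<Longrightarrow> 0 < w l"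
    and m: "sum w I - w m \<le> sum w I / 2" and c: "0 < c" "c * sum w I \<le> sum w I - w m"
  shows "log_odds_pot I w \<ge> sum w I * log 2 c"
proof -
  define s where "s = sum w I"
  have sm: "s - w m = sum w (I - {m})" unfolding s_def using I by (simp add: sum_diff1)
  have s: "s > 0" unfolding s_def using I w by (intro sum_pos) auto
  have wm: "0 < w m" using w I by simp
  have "0 \<le> w l * (log 2 (s - w l) - log 2 (w l))" if l: "l \<in> I - {m}" for l
  proof -
    have "w l \<le> s - w m" unfolding sm using l I w by (intro member_le_sum) (auto simp: less_imp_le)
    then have "w l \<le> s - w l" using m unfolding s_def[symmetric] by simp
    then show ?thesis using w[of l] l by (intro mult_nonneg_nonneg) auto
  qed
  then have 1: "0 \<le> (\<Sum>l\<in>I - {m}. w l * (log 2 (s - w l) - log 2 (w l)))" by (rule sum_nonneg)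
  have cs: "c * s \<le> s - w m" using c by (simp add: s_def)
  have "c * s < 1 * s" using cs wm by linarith
  then have c1: "c < 1" using s by simp
  have "s * log 2 c \<le> w m * log 2 c"
  proof -
    have "w m \<le> s" using cs c s mult_pos_pos[of c s] by linarith
    moreover have "log 2 c \<le> 0" using c c1 by simp
    ultimately show ?thesis by (rule mult_right_mono_neg)
  qed
  also have "w m * log 2 c \<le> w m * (log 2 (s - w m) - log 2 (w m))"
  proof (rule mult_left_mono)
    have "c * w m \<le> c * s" using cs c s mult_pos_pos[of c s] by (intro mult_left_mono) linarith+
    then have "c * w m \<le> s - w m" using cs by linarith
    then have "log 2 (c * w m) \<le> log 2 (s - w m)" using c wm by (subst log_le_cancel_iff) (use mult_pos_pos[OF c(1) wm] in linarith)+
    then show "log 2 c \<le> log 2 (s - w m) - log 2 (w m)" using c wm by (simp add: log_mult)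
  qed (use wm in simp)
  finally have "s * log 2 c \<le> w m * (log 2 (s - w m) - log 2 (w m)) + (\<Sum>l\<in>I - {m}. w l * (log 2 (s - w l) - log 2 (w l)))"
    using 1 by linarith
  also have "\<dots> = log_odds_pot I w"
    unfolding log_odds_pot_def s_def using I(1,3) by (rule sum.remove[symmetric])
  finally show ?thesis by (simp add: s_def)
qed

subsection \<open>Truncated runs\<close>

text \<open>The noise sequence is shifted at every step, so that the product measure can be split off
  one coordinate at a time.\<close>

fun run :: "(nat \<Rightarrow> bool list \<Rightarrow> nat list \<Rightarrow> nat) \<Rightarrow> (bool list \<Rightarrow> nat list \<Rightarrow> bool) \<Rightarrow> nat \<Rightarrow> nat
    \<Rightarrow> bool list \<times> nat list \<Rightarrow> nat \<Rightarrow> (nat \<Rightarrow> bool) \<Rightarrow> bool list \<times> nat list" where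
  "run f stop 0 k h l z = h"
| "run f stop (Suc r) k h l z =
     (if case_prod stop h then h
      else let u = case_prod (f k) h
        in run f stop r (Suc k) (fst h @ [(u < l) \<noteq> z 0], snd h @ [u]) l (\<lambda>i. z (Suc i)))"

text \<open>Backward induction over the responses for a fixed position: \<open>r\<close> queries
  remain and \<open>k\<close> have been made. \<open>nn_integral_run\<close> identifies the value
  with an expectation over the noise.\<close>

fun run_mean :: "(nat \<Rightarrow> bool list \<Rightarrow> nat list \<Rightarrow> nat) \<Rightarrow> (bool list \<Rightarrow> nat list \<Rightarrow> bool) \<Rightarrow> real
    \<Rightarrow> (bool list \<times> nat list \<Rightarrow> nat \<Rightarrow> real) \<Rightarrow> nat \<Rightarrow> nat \<Rightarrow> bool list \<times> nat list \<Rightarrow> nat \<Rightarrow> real" where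
  "run_mean f stop p g 0 k h l = g h l"
| "run_mean f stop p g (Suc r) k h l =
     (if case_prod stop h then g h l
      else let u = case_prod (f k) h
        in lik p u False l * run_mean f stop p g r (Suc k) (fst h @ [False], snd h @ [u]) l
         + lik p u True l * run_mean f stop p g r (Suc k) (fst h @ [True], snd h @ [u]) l)"

abbreviation noise :: "real \<Rightarrow> (nat \<Rightarrow> bool) measure" where
  "noise p \<equiv> \<Pi>\<^sub>M k\<in>(UNIV::nat set). measure_pmf (bernoulli_pmf p)"

lemma hist_Suc:
  "hist f l z (Suc k) = (let u = case_prod (f k) (hist f l z k)
     in (fst (hist f l z k) @ [(u < l) \<noteq> z k], snd (hist f l z k) @ [u]))"
  by (simp add: Let_def split_beta)

lemma length_hist: "length (fst (hist f l z k)) = k"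
  by (induction k) (simp_all add: split_beta Let_def)

text \<open>Matches the shifted recursion with \<open>hist\<close>. The witness \<open>m\<close> is
  the first stopping index from \<open>k\<close> on, capped at \<open>k + r\<close>; at the cap
  nothing is claimed about the stopping rule, because \<open>run\<close> does not test it
  there.\<close>

lemma run_eq_hist:
  "\<exists>m. k \<le> m \<and> m \<le> k + r \<and> run f stop r k (hist f l z k) l (\<lambda>i. z (k + i)) = hist f l z m \<and>
     (\<forall>j. k \<le> j \<and> j < m \<longrightarrow> \<not> case_prod stop (hist f l z j)) \<and>
     (m < k + r \<longrightarrow> case_prod stop (hist f l z m))"
proof (induction r arbitrary: k)
  case 0
  have "\<not> (k \<le> j \<and> j < k)" for j by linarith
  then show ?case by (intro exI[of _ k]) (simp only: run.simps add_0_right order_refl simp_thms less_irrefl)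
next
  case (Suc r)
  show ?case
  proof (cases "case_prod stop (hist f l z k)")
    case True
    show ?thesis
    proof (intro exI[of _ k] conjI allI impI)
      fix j assume "k \<le> j \<and> j < k"
      then have False by linarith
      then show "\<not> case_prod stop (hist f l z j)" ..
    qed (use True in simp_all)
  next
    case False
    obtain m where m: "Suc k \<le> m" "m \<le> Suc k + r"
      "run f stop r (Suc k) (hist f l z (Suc k)) l (\<lambda>i. z (Suc k + i)) = hist f l z m"
      "\<forall>j. Suc k \<le> j \<and> j < m \<longrightarrow> \<not> case_prod stop (hist f l z j)"
      "m < Suc k + r \<longrightarrow> case_prod stop (hist f l z m)"
      using Suc.IH[of "Suc k"] by (elim exE conjE) (rule that; assumption)
    define u where "u = case_prod (f k) (hist f l z k)"
    have hS: "hist f l z (Suc k) = (fst (hist f l z k) @ [(u < l) \<noteq> z k], snd (hist f l z k) @ [u])"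
      unfolding hist_Suc u_def Let_def by (rule refl)
    have "run f stop (Suc r) k (hist f l z k) l (\<lambda>i. z (k + i)) =
        run f stop r (Suc k) (fst (hist f l z k) @ [(u < l) \<noteq> z (k + 0)], snd (hist f l z k) @ [u]) l (\<lambda>i. z (k + Suc i))"
      by (simp only: run.simps if_not_P[OF False] Let_def u_def)
    also have "\<dots> = hist f l z m"
      using m(3) unfolding hS add_0_right add_Suc_right add_Suc .
    finally have 1: "run f stop (Suc r) k (hist f l z k) l (\<lambda>i. z (k + i)) = hist f l z m" .
    have 2: "\<not> case_prod stop (hist f l z j)" if j: "k \<le> j \<and> j < m" for j
    proof (cases "j = k")
      case True
      show ?thesis unfolding True by (rule False)
    next
      case False
      then have "Suc k \<le> j \<and> j < m" using j by linarith
      then show ?thesis by (rule m(4)[rule_format])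
    qed
    show ?thesis
    proof (intro exI[of _ m] conjI allI impI)
      show "k \<le> m" "m \<le> k + Suc r" using m(1,2) by linarith+
      show "case_prod stop (hist f l z m)" if "m < k + Suc r"
        using that by (intro m(5)[rule_format]) linarith
    qed (rule 1, rule 2)
  qed
qed

text \<open>A run meeting the stopping rule exactly at depth \<open>N\<close> counts as stopped, so
  testing \<open>stop\<close> on the final history decides which case holds.\<close>

lemma run_cases:
  obtains (stopped) m where "m \<le> N" "stop_time f stop l z = enat m"
      "run f stop N 0 ([], []) l z = hist f l z m" "case_prod stop (hist f l z m)"
  | (running) "stop_time f stop l z > enat N" "run f stop N 0 ([], []) l z = hist f l z N"
      "\<not> case_prod stop (hist f l z N)"
proof -
  define S where "S j \<longleftrightarrow> case_prod stop (hist f l z j)" for j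
  have st: "stop_time f stop l z = (if \<exists>k. S k then enat (LEAST k. S k) else \<infinity>)"
    unfolding stop_time_def S_def by (rule refl)
  obtain m where m: "0 \<le> m" "m \<le> 0 + N" "run f stop N 0 (hist f l z 0) l (\<lambda>i. z (0 + i)) = hist f l z m"
      "\<forall>j. 0 \<le> j \<and> j < m \<longrightarrow> \<not> S j" "m < 0 + N \<longrightarrow> S m"
    using run_eq_hist[of 0 N f stop l z, folded S_def] by (elim exE conjE) (rule that; assumption)
  have run: "run f stop N 0 ([], []) l z = hist f l z m" using m(3) by simp
  show thesis
  proof (cases "S m")
    case True
    have "(LEAST k. S k) = m"
      using True m(4) by (intro Least_equality) (assumption, meson le0 not_le)
    moreover have "\<exists>k. S k" using True by (rule exI)
    ultimately have "stop_time f stop l z = enat m"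
      unfolding st by (simp only: if_True)
    then show thesis
      using m(2) run True unfolding S_def by (intro stopped[of m]) simp_all
  next
    case False
    then have N: "m = N" using m(2,5) by auto
    have "N < k" if "S k" for k
    proof (rule ccontr)
      assume "\<not> N < k"
      then consider "k = m" | "k < m" using N by linarith
      then show False using that m(4) False by cases blast+
    qed
    then have "stop_time f stop l z > enat N"
    proof (cases "\<exists>k. S k")
      case True
      then have "S (LEAST k. S k)" by (rule LeastI_ex)
      then have "N < (LEAST k. S k)" by (rule \<open>\<And>k. S k \<Longrightarrow> N < k\<close>)
      then show ?thesis unfolding st if_P[OF True] by simp
    next
      case False
      then show ?thesis unfolding st if_not_P[OF False] by simp
    qed
    then show thesis
      using run False unfolding N S_def by (rule running)
  qed
qed

section \<open>Measurability and expectation of truncated runs\<close>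

lemma measurable_run: "(\<lambda>z. run f stop r k h l z) \<in> noise p \<rightarrow>\<^sub>M count_space UNIV"
proof (induction r arbitrary: k h)
  case 0
  show ?case by simp
next
  case (Suc r)
  define u where "u = case_prod (f k) h"
  have shift: "(\<lambda>z i. z (Suc i)) \<in> noise p \<rightarrow>\<^sub>M noise p"
    by (rule measurable_PiM_single') (auto simp: space_PiM)
  have [measurable]: "(\<lambda>z. run f stop r (Suc k) h' l (\<lambda>i. z (Suc i))) \<in> noise p \<rightarrow>\<^sub>M count_space UNIV" for h'
    using measurable_compose[OF shift Suc.IH] by simp
  have [measurable]: "Measurable.pred (noise p) (\<lambda>z. z 0)"
    by (rule measurable_compose[OF measurable_component_singleton]) simp_all
  \<comment> \<open>After a split on \<open>z 0\<close>, each branch sees only the shifted sequence,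
    to which the induction hypothesis applies.\<close>
  have *: "run f stop (Suc r) k h l z = (if case_prod stop h then h else if z 0 
     then run f stop r (Suc k) (fst h @ [\<not> (u < l)], snd h @ [u]) l (\<lambda>i. z (Suc i))
     else run f stop r (Suc k) (fst h @ [u < l], snd h @ [u]) l (\<lambda>i. z (Suc i)))" for z
    by (simp add: u_def Let_def)
  show ?case unfolding * by measurable
qed

lemma run_mean_nonneg:
  assumes "0 \<le> p" "p \<le> 1" "\<And>h l. 0 \<le> g h l"
  shows "0 \<le> run_mean f stop p g r k h l"
  by (induction r arbitrary: k h) (auto simp: Let_def lik_def assms)

lemma nn_integral_run:
  assumes p: "0 \<le> p" "p \<le> 1" and g: "\<And>h l. 0 \<le> g h l"
  shows "(\<integral>\<^sup>+z. ennreal (g (run f stop r k h l z) l) \<partial>noise p) = ennreal (run_mean f stop p g r k h l)"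
proof -
  interpret sequence_space "measure_pmf (bernoulli_pmf p)"
    by unfold_locales
  show ?thesis
  proof (induction r arbitrary: k h)
    case 0
    show ?case by (simp add: emeasure_space_1)
  next
    case (Suc r)
    define u where "u = case_prod (f k) h"
    define h' where "h' y = (fst h @ [y], snd h @ [u])" for y
    show ?case
    proof (cases "case_prod stop h")
      case True
      then show ?thesis by (simp add: emeasure_space_1)
    next
      case False
      let ?G = "\<lambda>z. ennreal (g (run f stop (Suc r) k h l z) l)"
      have G: "?G \<in> borel_measurable (noise p)"
        by (rule measurable_compose[OF measurable_run, where g = "\<lambda>h. ennreal (g h l)"]) simp
      \<comment> \<open>By \<open>PiM_iter\<close> an i.i.d. sequence is one Bernoulli coordinate
        followed by an independent i.i.d. sequence; prepending with \<open>case_nat\<close> leaves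
        the tail to the induction hypothesis.\<close>
      have comb: "(\<lambda>(s, \<omega>). case_nat s \<omega>) \<in> measure_pmf (bernoulli_pmf p) \<Otimes>\<^sub>M noise p \<rightarrow>\<^sub>M noise p"
        by measurable
      have "(\<integral>\<^sup>+z. ?G z \<partial>noise p) = (\<integral>\<^sup>+z. ?G z \<partial>distr (measure_pmf (bernoulli_pmf p) \<Otimes>\<^sub>M noise p) (noise p) (\<lambda>(s, \<omega>). case_nat s \<omega>))"
        by (simp only: PiM_iter)
      also have "\<dots> = (\<integral>\<^sup>+x. ?G (case x of (s, \<omega>) \<Rightarrow> case_nat s \<omega>) \<partial>(measure_pmf (bernoulli_pmf p) \<Otimes>\<^sub>M noise p))"
        by (rule nn_integral_distr[OF comb]) (simp add: G del: run.simps)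
      also have "\<dots> = (\<integral>\<^sup>+s. \<integral>\<^sup>+\<omega>. ?G (case_nat s \<omega>) \<partial>noise p \<partial>measure_pmf (bernoulli_pmf p))"
        using measurable_compose[OF comb G] by (subst nn_integral_fst[symmetric]) simp_all
      also have "\<dots> = (\<integral>\<^sup>+s. ennreal (run_mean f stop p g r (Suc k) (h' ((u < l) \<noteq> s)) l) \<partial>measure_pmf (bernoulli_pmf p))"
        using False by (simp add: Suc.IH[symmetric] Let_def u_def[symmetric] h'_def)
      also have "\<dots> = ennreal (run_mean f stop p g r (Suc k) (h' (\<not> (u < l))) l) * ennreal p
          + ennreal (run_mean f stop p g r (Suc k) (h' (u < l)) l) * ennreal (1 - p)"
        using p by simp
      also have "\<dots> = ennreal (run_mean f stop p g (Suc r) k h l)"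
        using False p run_mean_nonneg[of p g, OF p g]
        by (cases "u < l") (simp_all add: Let_def u_def[symmetric] h'_def lik_def ennreal_mult[symmetric] ennreal_plus[symmetric] mult.commute add.commute del: ennreal_plus)
      finally show ?thesis .
    qed
  qed
qed

subsection \<open>Potentials on the decision tree\<close>

text \<open>The first disjunct of the first premise lets a potential hand over to another one that has
  already been treated.\<close>

lemma potential_le_run_mean:
  fixes V :: "(nat \<Rightarrow> real) \<Rightarrow> real" and \<alpha> \<beta> :: real
    and g :: "bool list \<times> nat list \<Rightarrow> nat \<Rightarrow> real"
  assumes leaf_or_step: "\<And>w. G w \<Longrightarrow>
      (\<forall>r k h. length (fst h) = k \<longrightarrow> V w + sum w I * k \<le> (\<Sum>l\<in>I. w l * run_mean f stop p g r k h l)) \<or>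
      ((\<forall>j\<in>I. V w \<le> \<alpha> * (sum w I - w j) + \<beta> * sum w I) \<and>
       (\<forall>u. V w \<le> sum w I + V (update p u False w) + V (update p u True w)
          \<and> G (update p u False w) \<and> G (update p u True w)))"
    and g: "\<And>h l. g h l = length (fst h) + \<alpha> * of_bool (case_prod est h \<noteq> l) + \<beta>"
    and est: "\<And>h. case_prod est h \<in> I" and I: "finite I"
    and G: "G w" and k: "length (fst h) = k"
  shows "V w + sum w I * k \<le> (\<Sum>l\<in>I. w l * run_mean f stop p g r k h l)"
proof -
  have leaf: "V w + sum w I * length (fst h) \<le> (\<Sum>l\<in>I. w l * g h l)"
    if "\<forall>j\<in>I. V w \<le> \<alpha> * (sum w I - w j) + \<beta> * sum w I" for w and h
  proof -
    define j where "j = case_prod est h"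
    have j: "j \<in> I" using est by (simp add: j_def)
    have "(\<Sum>l\<in>I. w l * of_bool (j \<noteq> l)) = (\<Sum>l\<in>I. w l - (if j = l then w l else 0))"
      by (intro sum.cong) auto
    also have "\<dots> = sum w I - w j"
      using I j by (simp add: sum_subtractf)
    finally have e: "(\<Sum>l\<in>I. w l * of_bool (j \<noteq> l)) = sum w I - w j" .
    have "(\<Sum>l\<in>I. w l * g h l) =
      (\<Sum>l\<in>I. length (fst h) * w l + \<alpha> * (w l * of_bool (j \<noteq> l)) + \<beta> * w l)"
      unfolding g j_def by (intro sum.cong) (simp_all add: algebra_simps)
    also have "\<dots> = length (fst h) * sum w I + \<alpha> * (sum w I - w j) + \<beta> * sum w I"
      unfolding e[symmetric] by (simp only: sum.distrib sum_distrib_left)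
    finally show ?thesis using bspec[OF that j] by (simp add: algebra_simps)
  qed
  show ?thesis using G k
  proof (induction r arbitrary: k h w)
    case 0
    from leaf_or_step[OF 0(1)] show ?case
    proof
      assume "\<forall>r k h. length (fst h) = k \<longrightarrow> V w + sum w I * k \<le> (\<Sum>l\<in>I. w l * run_mean f stop p g r k h l)"
      then show ?thesis using 0 by blast
    qed (use leaf[of w h] 0 in simp)
  next
    case (Suc r)
    from leaf_or_step[OF Suc.prems(1)] show ?case
    proof
      assume "\<forall>r k h. length (fst h) = k \<longrightarrow> V w + sum w I * k \<le> (\<Sum>l\<in>I. w l * run_mean f stop p g r k h l)"
      then show ?thesis using Suc.prems by blast
    next
      assume *: "(\<forall>j\<in>I. V w \<le> \<alpha> * (sum w I - w j) + \<beta> * sum w I) \<and>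
       (\<forall>u. V w \<le> sum w I + V (update p u False w) + V (update p u True w)
          \<and> G (update p u False w) \<and> G (update p u True w))"
      show ?thesis
      proof (cases "case_prod stop h")
        case True
        then show ?thesis using leaf[of w h] * Suc.prems by simp
      next
        case False
        define u where "u = case_prod (f k) h"
        define h' where "h' y = (fst h @ [y], snd h @ [u])" for y
        let ?m = "\<lambda>y l. run_mean f stop p g r (Suc k) (h' y) l"
        have h': "length (fst (h' y)) = Suc k" for y using Suc.prems by (simp add: h'_def)
        have IH: "V (update p u y w) + sum (update p u y w) I * Suc k
            \<le> (\<Sum>l\<in>I. update p u y w l * ?m y l)" for y
          using * h' by (intro Suc.IH) (cases y; simp)+
        have "V w + sum w I * k
          \<le> sum w I + V (update p u False w) + V (update p u True w) + sum w I * k"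
          using * by simp
        \<comment> \<open>The allowance \<open>sum w I\<close> for one query raises the depth factor
          from \<open>k\<close> to \<open>Suc k\<close>, and the mass splits between the
          children.\<close>
        also have "\<dots> = (V (update p u False w) + sum (update p u False w) I * Suc k)
             + (V (update p u True w) + sum (update p u True w) I * Suc k)"
          unfolding sum_update_add[of p u w I, symmetric] by (simp add: algebra_simps)
        also have "\<dots> \<le> (\<Sum>l\<in>I. update p u False w l * ?m False l)
             + (\<Sum>l\<in>I. update p u True w l * ?m True l)"
          by (intro add_mono IH)
        also have "\<dots> = (\<Sum>l\<in>I. w l * run_mean f stop p g (Suc r) k h l)"
          unfolding sum.distrib[symmetric] using False
          by (intro sum.cong) (simp_all add: Let_def u_def[symmetric] h'_def update_def algebra_simps)
        finally show ?thesis .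
      qed
    qed
  qed
qed

section \<open>The potential bounds for noiseless and noisy responses\<close>

lemma update_pos:
  assumes "0 < p" "p < 1" "0 < w l"
  shows "0 < update p u y w l"
  using assms by (simp add: update_def lik_def)

lemma update_nonneg:
  assumes "0 \<le> p" "p \<le> 1" "0 \<le> w l"
  shows "0 \<le> update p u y w l"
  using assms by (simp add: update_def lik_def)

text \<open>Without noise the capacity is 1 and the entropy never hands over to another potential.
  Updates may set weights to zero, so the invariant is nonnegativity.\<close>

lemma noiseless_potential_bound:
  fixes g :: "bool list \<times> nat list \<Rightarrow> nat \<Rightarrow> real"
  assumes g: "\<And>h l. g h l = length (fst h) + log 2 (card I) * of_bool (case_prod est h \<noteq> l) + 1 / ln 2"
    and est: "\<And>h. case_prod est h \<in> I" and I: "finite I"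
    and w: "\<And>l. l \<in> I \<Longrightarrow> 0 \<le> w l" and k: "length (fst h) = k"
  shows "entropy_pot I w + sum w I * k \<le> (\<Sum>l\<in>I. w l * run_mean f stop 0 g r k h l)"
proof (rule potential_le_run_mean[where G = "\<lambda>w. \<forall>l\<in>I. 0 \<le> w l", OF disjI2 g est I _ k])
  fix w :: "nat \<Rightarrow> real" assume w: "\<forall>l\<in>I. 0 \<le> w l"
  have "entropy_pot I w \<le> sum w I + entropy_pot I (update 0 u False w) + entropy_pot I (update 0 u True w)" for u
    using entropy_pot_step[of I w 0 u] I w by (simp add: H2_def)
  moreover have "entropy_pot I w \<le> log 2 (card I) * (sum w I - w j) + 1 / ln 2 * sum w I" if "j \<in> I" for j
    using entropy_pot_le[of I j w] I w that by (simp add: mult.commute)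
  ultimately show "(\<forall>j\<in>I. entropy_pot I w \<le> log 2 (card I) * (sum w I - w j) + 1 / ln 2 * sum w I) \<and>
      (\<forall>u. entropy_pot I w \<le> sum w I + entropy_pot I (update 0 u False w) + entropy_pot I (update 0 u True w)
         \<and> (\<forall>l\<in>I. 0 \<le> update 0 u False w l) \<and> (\<forall>l\<in>I. 0 \<le> update 0 u True w l))"
    using w by (auto intro!: update_nonneg)
qed (use w in auto)

text \<open>The parameter t is the point where log is replaced by its tangent. The premise on the mass
  outside m holds at the root and survives every update made before the switch: an update changes
  weights by factors between p and 1, so a spread of \<delta> before it leaves at least p \<delta> after it.\<close>

lemma noisy_potential_bound:
  fixes p t \<alpha> \<beta> :: real and g :: "bool list \<times> nat list \<Rightarrow> nat \<Rightarrow> real"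
  assumes p: "0 < p" "p < 1/2" and t: "0 < t" "t \<le> 1"
    and n: "card I \<ge> 2" and I: "finite I"
    and \<delta>: "\<delta> = 1 / (2 * log 2 (card I))"
    and \<kappa>: "\<kappa> = (1/2 + 1 / ln 2) / (1 - H2 p) - log 2 (p * \<delta>) / Dkl p"
    and \<alpha>: "\<alpha> = log 2 (card I) / (1 - H2 p) + (1 / (t * ln 2) - log 2 t) / Dkl p"
    and \<beta>: "\<beta> = \<kappa> + (1 / ln 2 + log 2 t) / Dkl p"
    and g: "\<And>h l. g h l = length (fst h) + \<alpha> * of_bool (case_prod est h \<noteq> l) + \<beta>"
    and est: "\<And>h. case_prod est h \<in> I"
    and w: "\<And>l. l \<in> I \<Longrightarrow> 0 < w l" and k: "length (fst h) = k"
    and spread: "\<And>m. m \<in> I \<Longrightarrow> p * \<delta> * sum w I \<le> sum w I - w m"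
  shows "entropy_pot I w / (1 - H2 p) + sum w I * k \<le> (\<Sum>l\<in>I. w l * run_mean f stop p g r k h l)"
proof -
  define b where "b = 1 / Dkl p"
  define c where "c = 1 / (1 - H2 p)"
  have C: "0 < 1 - H2 p" using H2_less_1[of p] p by simp
  have cb: "0 < b" "b \<le> c" "0 < c"
    using C capacity_le_Dkl[OF p] by (auto simp: b_def c_def frac_le)
  have L: "log 2 (card I) \<ge> 1" using n by (simp add: le_log_iff)
  have \<delta>0: "0 < \<delta>" "\<delta> \<le> 1/2" using L by (auto simp: \<delta> field_simps)
  have D: "Dkl p > 0" using cb(1) by (simp add: b_def)
  have \<kappa>': "\<kappa> = c / 2 + c / ln 2 - b * log 2 p - b * log 2 \<delta>"
  proof -
    have "\<kappa> = (1/2 + 1 / ln 2) * c - (log 2 p + log 2 \<delta>) * b"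
      using p \<delta>0 by (simp add: \<kappa> b_def c_def log_mult)
    then show ?thesis by (simp add: algebra_simps)
  qed
  have \<alpha>': "\<alpha> = c * log 2 (card I) + b / (t * ln 2) - b * log 2 t"
    by (simp add: \<alpha> b_def c_def diff_divide_distrib)
  have \<beta>': "\<beta> = \<kappa> + b / ln 2 + b * log 2 t"
    by (simp add: \<beta> b_def add_divide_distrib)
  have lp: "log 2 p \<le> 0" "log 2 \<delta> \<le> 0" "log 2 t \<le> 0" using p \<delta>0 t by auto
  have sumpos: "0 < sum w I" if "\<forall>l\<in>I. 0 < w l" for w :: "nat \<Rightarrow> real"
    using that n I by (intro sum_pos) (auto simp: card_gt_0_iff)
  \<comment> \<open>The potential after the switch. A query conserves the multiple
    \<open>\<kappa>\<close> of the mass, and the factor \<open>b\<close> scales the log-odds so that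
    a query costs at most the mass.\<close>
  have phase2: "b * log_odds_pot I w + \<kappa> * sum w I + sum w I * k
      \<le> (\<Sum>l\<in>I. w l * run_mean f stop p g r k h l)"
    if "\<forall>l\<in>I. 0 < w l" "length (fst h) = k" for w r k h
  proof (rule potential_le_run_mean[where G = "\<lambda>w. \<forall>l\<in>I. 0 < w l", OF disjI2 g est I that])
    fix w :: "nat \<Rightarrow> real" assume w: "\<forall>l\<in>I. 0 < w l"
    have "b * log_odds_pot I w + \<kappa> * sum w I \<le> \<alpha> * (sum w I - w j) + \<beta> * sum w I" if j: "j \<in> I" for j
    proof -
      have "0 \<le> sum w I - w j" using member_le_sum[of j I w] j w I by (simp add: less_imp_le)
      \<comment> \<open>Here \<open>1 - H2 p \<le> Dkl p\<close> enters: one \<open>\<alpha>\<close>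
        serves for stops before and after the switch.\<close>
      then have "(sum w I - w j) * (b * log 2 (card I)) \<le> (sum w I - w j) * (c * log 2 (card I))"
        using cb L by (intro mult_left_mono mult_right_mono) auto
      moreover have "b * log_odds_pot I w \<le> b * ((sum w I - w j) * (log 2 (card I) + 1 / (t * ln 2) - log 2 t)
          + sum w I * (1 / ln 2 + log 2 t))"
        using cb w by (intro mult_left_mono log_odds_pot_le I n j t) auto
      ultimately show ?thesis unfolding \<alpha>' \<beta>' by (simp add: algebra_simps)
    qed
    moreover have "b * log_odds_pot I w + \<kappa> * sum w I \<le> sum w I
        + (b * log_odds_pot I (update p u False w) + \<kappa> * sum (update p u False w) I)
        + (b * log_odds_pot I (update p u True w) + \<kappa> * sum (update p u True w) I)" for u
    proof -
      have "b * log_odds_pot I w \<le> b * (Dkl p * sum w I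
        + log_odds_pot I (update p u False w) + log_odds_pot I (update p u True w))"
        using cb w by (intro mult_left_mono log_odds_pot_step I n p) auto
      moreover have "b * Dkl p = 1" using D by (simp add: b_def)
      ultimately show ?thesis
        unfolding sum_update_add[of p u w I, symmetric] by (simp add: algebra_simps mult.assoc[symmetric])
    qed
    ultimately show "(\<forall>j\<in>I. b * log_odds_pot I w + \<kappa> * sum w I \<le> \<alpha> * (sum w I - w j) + \<beta> * sum w I) \<and>
      (\<forall>u. b * log_odds_pot I w + \<kappa> * sum w I \<le> sum w I
        + (b * log_odds_pot I (update p u False w) + \<kappa> * sum (update p u False w) I)
        + (b * log_odds_pot I (update p u True w) + \<kappa> * sum (update p u True w) I) \<and>
        (\<forall>l\<in>I. 0 < update p u False w l) \<and> (\<forall>l\<in>I. 0 < update p u True w l))"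
      using w p by (auto intro!: update_pos)
  qed
  define G where "G w \<longleftrightarrow> (\<forall>l\<in>I. 0 < w l \<and> p * \<delta> * sum w I \<le> sum w I - w l)" for w :: "nat \<Rightarrow> real"
  show ?thesis
  proof (rule potential_le_run_mean[where G = G, OF _ g est I _ k])
    fix w assume Gw: "G w"
    then have w: "\<forall>l\<in>I. 0 < w l" by (simp add: G_def)
    have s: "0 < sum w I" by (rule sumpos[OF w])
    show "(\<forall>r k h. length (fst h) = k \<longrightarrow> entropy_pot I w / (1 - H2 p) + sum w I * k
          \<le> (\<Sum>l\<in>I. w l * run_mean f stop p g r k h l)) \<or>
      ((\<forall>j\<in>I. entropy_pot I w / (1 - H2 p) \<le> \<alpha> * (sum w I - w j) + \<beta> * sum w I) \<and>
       (\<forall>u. entropy_pot I w / (1 - H2 p) \<le> sum w I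
            + entropy_pot I (update p u False w) / (1 - H2 p) + entropy_pot I (update p u True w) / (1 - H2 p)
          \<and> G (update p u False w) \<and> G (update p u True w)))"
    proof (cases "\<exists>m\<in>I. sum w I - w m \<le> \<delta> * sum w I")
      case True
      then obtain m where m: "m \<in> I" "sum w I - w m \<le> \<delta> * sum w I" by blast
      have "entropy_pot I w \<le> (sum w I - w m) * log 2 (card I) + sum w I / ln 2"
        using w by (intro entropy_pot_le I m) (auto simp: less_imp_le)
      also have "\<dots> \<le> (\<delta> * sum w I) * log 2 (card I) + sum w I / ln 2"
        using m L by (intro add_right_mono mult_right_mono) auto
      \<comment> \<open>The choice of \<open>\<delta>\<close> gives
        \<open>\<delta> * log 2 (card I) = 1/2\<close>, so the entropy per unit of mass at the
        switch is bounded independently of \<open>n\<close>.\<close>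
      also have "\<dots> = sum w I / 2 + sum w I / ln 2" using L by (simp add: \<delta>)
      finally have "c * entropy_pot I w \<le> c * (sum w I / 2 + sum w I / ln 2)"
        using cb by (intro mult_left_mono) auto
      moreover have "sum w I * log 2 (p * \<delta>) \<le> log_odds_pot I w"
      proof (rule log_odds_pot_ge[OF I n m(1)])
        have "\<delta> * sum w I \<le> 1/2 * sum w I" using \<delta>0 s by (intro mult_right_mono) auto
        then show "sum w I - w m \<le> sum w I / 2" using m by simp
        show "p * \<delta> * sum w I \<le> sum w I - w m" using Gw m by (simp add: G_def)
      qed (use w p \<delta>0 in auto)
      then have "b * (sum w I * log 2 (p * \<delta>)) \<le> b * log_odds_pot I w" using cb by simp
      \<comment> \<open>\<open>\<kappa>\<close> is the price of the change of potential: the entropy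
        left over plus the deficit \<open>- log 2 (p * \<delta>)\<close> of the log-odds, each in
        its own scale.\<close>
      ultimately have "c * entropy_pot I w \<le> b * log_odds_pot I w + \<kappa> * sum w I"
        unfolding \<kappa>' using p \<delta>0 by (simp add: log_mult algebra_simps)
      then have switch: "entropy_pot I w / (1 - H2 p) \<le> b * log_odds_pot I w + \<kappa> * sum w I"
        by (simp add: c_def)
      show ?thesis
      proof (intro disjI1 allI impI)
        fix r k and h :: "bool list \<times> nat list" assume "length (fst h) = k"
        from add_right_mono[OF switch, of "sum w I * k"] phase2[OF w this, of r]
        show "entropy_pot I w / (1 - H2 p) + sum w I * k \<le> (\<Sum>l\<in>I. w l * run_mean f stop p g r k h l)"
          by (rule order_trans)
      qed
    next
      case False
      have "entropy_pot I w / (1 - H2 p) \<le> \<alpha> * (sum w I - w j) + \<beta> * sum w I" if j: "j \<in> I" for j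
      proof -
        define e where "e = sum w I - w j"
        have e: "\<delta> * sum w I \<le> e" using False j by (force simp: e_def)
        have e0: "0 < e" using e \<delta>0 s mult_pos_pos[of \<delta> "sum w I"] by linarith
        have "entropy_pot I w \<le> e * log 2 (card I) + sum w I / ln 2"
          unfolding e_def using w by (intro entropy_pot_le I j) (auto simp: less_imp_le)
        then have 1: "c * entropy_pot I w \<le> c * (e * log 2 (card I) + sum w I / ln 2)"
          using cb by (intro mult_left_mono) auto
        \<comment> \<open>\<open>\<beta>\<close> contains \<open>b * log 2 t\<close>, which can be
          very negative. A stop before the switch has error mass at least
          \<open>\<delta> * sum w I\<close>, so by the tangent at \<open>t\<close> the part
          \<open>b * e / (t * ln 2)\<close> of \<open>\<alpha> * e\<close> together with
          \<open>- b * log 2 \<delta>\<close> in \<open>\<kappa>\<close> compensates for it.\<close>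
        have "sum w I * (log 2 (e / t) - log 2 (sum w I)) \<le> (e / t - sum w I) / ln 2"
          using e0 s t by (intro mult_log_le) auto
        moreover have "log 2 (\<delta> * sum w I) \<le> log 2 e" using e e0 s \<delta>0 by simp
        then have "sum w I * (log 2 \<delta> + log 2 (sum w I)) \<le> sum w I * log 2 e"
          using s \<delta>0 by (simp add: log_mult)
        ultimately have "sum w I * log 2 \<delta> \<le> sum w I * log 2 t + (e / t - sum w I) / ln 2"
          using e0 t s by (simp add: log_divide algebra_simps)
        also have "\<dots> \<le> sum w I * log 2 t + e / (t * ln 2) + sum w I / ln 2"
        proof -
          have "0 \<le> sum w I / ln 2" using s by simp
          then show ?thesis by (simp add: diff_divide_distrib)
        qed
        finally have 2: "b * (sum w I * log 2 \<delta>) \<le> b * (sum w I * log 2 t + e / (t * ln 2) + sum w I / ln 2)"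
          using cb by (intro mult_left_mono) auto
        have "0 \<le> b * (- log 2 t) * e" "0 \<le> b * (- log 2 p) * sum w I" "0 \<le> c * sum w I"
          by (intro mult_nonneg_nonneg; use cb lp e0 s in linarith)+
        then have "c * entropy_pot I w \<le> \<alpha> * e + \<beta> * sum w I"
          using 1 2 unfolding \<alpha>' \<beta>' \<kappa>' by (simp add: algebra_simps)
        then show ?thesis by (simp add: c_def e_def)
      qed
      moreover have "entropy_pot I w / (1 - H2 p) \<le> sum w I
            + entropy_pot I (update p u False w) / (1 - H2 p) + entropy_pot I (update p u True w) / (1 - H2 p)" for u
      proof -
        have "entropy_pot I w / (1 - H2 p) \<le> ((1 - H2 p) * sum w I + entropy_pot I (update p u False w)
            + entropy_pot I (update p u True w)) / (1 - H2 p)"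
          using w p C by (intro divide_right_mono entropy_pot_step I) (auto simp: less_imp_le)
        then show ?thesis using C by (simp add: add_divide_distrib)
      qed
      moreover have "G (update p u y w)" for u y
        unfolding G_def
      proof (intro ballI conjI)
        fix l assume l: "l \<in> I"
        show "0 < update p u y w l" using w l p by (intro update_pos) auto
        have "sum (update p u y w) I \<le> sum w I"
          using w p by (intro sum_mono) (auto simp: update_def lik_def mult_le_cancel_left2 less_imp_le)
        then have "p * \<delta> * sum (update p u y w) I \<le> p * \<delta> * sum w I"
          using p \<delta>0 by (intro mult_left_mono) auto
        also have "\<dots> \<le> p * (sum w I - w l)"
          using False l p by (force simp: mult.assoc)
        also have "\<dots> = (\<Sum>i\<in>I - {l}. p * w i)"
          using l I by (simp add: sum_diff1 sum_distrib_left[symmetric])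
        also have "\<dots> \<le> (\<Sum>i\<in>I - {l}. update p u y w i)"
          using w p by (intro sum_mono) (auto simp: update_def lik_def mult.commute)
        also have "\<dots> = sum (update p u y w) I - update p u y w l"
          using l I by (simp add: sum_diff1)
        finally show "p * \<delta> * sum (update p u y w) I \<le> sum (update p u y w) I - update p u y w l" .
      qed
      ultimately show ?thesis by blast
    qed
  qed (use w spread in \<open>auto simp: G_def\<close>)
qed

subsection \<open>From the decision tree to the probability space\<close>

lemma run_mean_affine:
  "run_mean f stop p (\<lambda>h l. a h l + \<alpha> * b h l + \<beta>) r k h l =
     run_mean f stop p a r k h l + \<alpha> * run_mean f stop p b r k h l + \<beta>"
proof (induction r arbitrary: k h)
  case (Suc r)
  have lik: "lik p u True l = 1 - lik p u False l" for u by (simp add: lik_def)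
  show ?case
  proof (cases "case_prod stop h")
    case False
    show ?thesis
      unfolding run_mean.simps if_not_P[OF False] Let_def Suc.IH lik by (simp add: algebra_simps)
  qed simp
qed simp

lemma prob_space_search_space: "prob_space (search_space n p)"
  unfolding search_space_def
  by (intro prob_space_pair prob_space_PiM prob_space_measure_pmf)

lemma measurable_fst_search_space: "fst \<in> search_space n p \<rightarrow>\<^sub>M count_space UNIV"
  unfolding search_space_def by (rule measurable_compose[OF measurable_fst]) simp

lemma measurable_run_search_space:
  "(\<lambda>\<omega>. run f stop N 0 ([], []) (fst \<omega>) (snd \<omega>)) \<in> search_space n p \<rightarrow>\<^sub>M count_space UNIV"
proof (rule measurable_compose_countable[where g = fst])
  show "(\<lambda>\<omega>. run f stop N 0 ([], []) i (snd \<omega>)) \<in> search_space n p \<rightarrow>\<^sub>M count_space UNIV" for i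
    unfolding search_space_def by (rule measurable_compose[OF measurable_snd measurable_run])
qed (rule measurable_fst_search_space)

lemma nn_integral_run_search_space:
  assumes p: "0 \<le> p" "p \<le> 1" and n: "n \<ge> 1" and g: "\<And>h l. 0 \<le> g h l"
  shows "(\<integral>\<^sup>+\<omega>. ennreal (g (run f stop N 0 ([], []) (fst \<omega>) (snd \<omega>)) (fst \<omega>)) \<partial>search_space n p)
    = ennreal (\<Sum>l\<in>{1..n}. 1 / n * run_mean f stop p g N 0 ([], []) l)"
proof -
  interpret N: prob_space "noise p" by (intro prob_space_PiM prob_space_measure_pmf)
  interpret P: pair_sigma_finite "measure_pmf (pmf_of_set {1..n})" "noise p" ..
  let ?F = "\<lambda>\<omega>. ennreal (g (run f stop N 0 ([], []) (fst \<omega>) (snd \<omega>)) (fst \<omega>))"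
  have "(\<lambda>\<omega>. ennreal (g (run f stop N 0 ([], []) (fst \<omega>) (snd \<omega>)) l)) \<in> borel_measurable (search_space n p)" for l
    by (rule measurable_compose[OF measurable_run_search_space, where g = "\<lambda>h. ennreal (g h l)"]) simp
  then have F: "?F \<in> borel_measurable (search_space n p)"
    by (rule measurable_compose_countable[OF _ measurable_fst_search_space])
  have "(\<integral>\<^sup>+\<omega>. ?F \<omega> \<partial>search_space n p) = (\<integral>\<^sup>+l. \<integral>\<^sup>+z. ?F (l, z) \<partial>noise p \<partial>measure_pmf (pmf_of_set {1..n}))"
    using F unfolding search_space_def by (rule N.nn_integral_fst[symmetric])
  also have "\<dots> = (\<integral>\<^sup>+l. ennreal (run_mean f stop p g N 0 ([], []) l) \<partial>measure_pmf (pmf_of_set {1..n}))"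
    by (simp only: fst_conv snd_conv nn_integral_run[OF p, of g, OF g])
  also have "\<dots> = ennreal (\<Sum>l\<in>{1..n}. run_mean f stop p g N 0 ([], []) l) / n"
    using n run_mean_nonneg[OF p g] by (subst nn_integral_pmf_of_set) (simp_all add: sum_ennreal)
  also have "\<dots> = ennreal ((\<Sum>l\<in>{1..n}. run_mean f stop p g N 0 ([], []) l) / n)"
    using n run_mean_nonneg[OF p g]
    by (simp add: ennreal_of_nat_eq_real_of_nat divide_ennreal sum_nonneg)
  finally show ?thesis by (simp add: sum_divide_distrib)
qed

definition trunc_queries :: "(nat \<Rightarrow> bool list \<Rightarrow> nat list \<Rightarrow> nat) \<Rightarrow> (bool list \<Rightarrow> nat list \<Rightarrow> bool)
    \<Rightarrow> nat \<Rightarrow> real \<Rightarrow> nat \<Rightarrow> real" where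
  "trunc_queries f stop n p N =
     (\<Sum>l\<in>{1..n}. 1 / n * run_mean f stop p (\<lambda>h l. length (fst h)) N 0 ([], []) l)"

text \<open>A run cut off at depth \<open>N\<close> is judged by the estimate from its history
  there.\<close>

definition trunc_err :: "(nat \<Rightarrow> bool list \<Rightarrow> nat list \<Rightarrow> nat) \<Rightarrow> (bool list \<Rightarrow> nat list \<Rightarrow> bool)
    \<Rightarrow> (bool list \<Rightarrow> nat list \<Rightarrow> nat) \<Rightarrow> nat \<Rightarrow> real \<Rightarrow> nat \<Rightarrow> real" where
  "trunc_err f stop est n p N =
     (\<Sum>l\<in>{1..n}. 1 / n * run_mean f stop p (\<lambda>h l. of_bool (case_prod est h \<noteq> l)) N 0 ([], []) l)"

lemma trunc_queries_le:
  assumes "0 \<le> p" "p \<le> 1" "n \<ge> 1"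
  shows "ennreal (trunc_queries f stop n p N) \<le> exp_queries f stop n p"
proof -
  have "ennreal (length (fst (run f stop N 0 ([], []) l z))) \<le> ennreal_of_enat (stop_time f stop l z)" for l z
    by (cases rule: run_cases[of N f stop l z])
      (auto simp: length_hist ennreal_of_nat_eq_real_of_nat[symmetric] ennreal_of_enat_enat[symmetric]
        simp del: ennreal_of_enat_enat)
  then show ?thesis
    unfolding trunc_queries_def exp_queries_def using assms
    by (subst nn_integral_run_search_space[symmetric]) (auto intro!: nn_integral_mono)
qed

text \<open>A truncated run errs only if the full scheme errs or has not stopped after
  \<open>N\<close> queries; Markov's inequality bounds the probability of the second event.\<close>

lemma trunc_err_le:
  assumes p: "0 \<le> p" "p \<le> 1" and n: "n \<ge> 1" and Pe: "err_prob f stop est n p > 0"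
    and fin: "exp_queries f stop n p < \<infinity>" and N: "N > 0"
  shows "trunc_err f stop est n p N \<le> err_prob f stop est n p + enn2real (exp_queries f stop n p) / N"
proof -
  interpret prob_space "search_space n p" by (rule prob_space_search_space)
  let ?S = "search_space n p"
  let ?run = "\<lambda>\<omega>. run f stop N 0 ([], []) (fst \<omega>) (snd \<omega>)"
  define E where "E = {\<omega> \<in> space ?S. (case stop_time f stop (fst \<omega>) (snd \<omega>) of
           \<infinity> \<Rightarrow> True
         | enat m \<Rightarrow> case_prod est (hist f (fst \<omega>) (snd \<omega>) m) \<noteq> fst \<omega>)}"
  define T where "T = {\<omega> \<in> space ?S. \<not> case_prod stop (?run \<omega>)}"
  have PeE: "err_prob f stop est n p = measure ?S E" by (simp add: err_prob_def E_def)
  \<comment> \<open>A set of positive measure is measurable, since \<open>measure\<close> is 0 outside \<open>sets\<close>.\<close>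
  have E: "E \<in> sets ?S" using Pe unfolding PeE by (metis less_irrefl measure_notin_sets)
  have "Measurable.pred ?S (\<lambda>\<omega>. \<not> case_prod stop (?run \<omega>))"
    by (rule measurable_compose[OF measurable_run_search_space, where g = "\<lambda>h. \<not> case_prod stop h"]) simp
  then have T: "T \<in> sets ?S" unfolding T_def by simp
  have "ennreal (trunc_err f stop est n p N)
      = (\<integral>\<^sup>+\<omega>. ennreal (of_bool (case_prod est (?run \<omega>) \<noteq> fst \<omega>)) \<partial>?S)"
    unfolding trunc_err_def using p n by (subst nn_integral_run_search_space) auto
  also have "\<dots> \<le> (\<integral>\<^sup>+\<omega>. indicator E \<omega> + indicator T \<omega> \<partial>?S)"
  proof (rule nn_integral_mono)
    fix \<omega> assume "\<omega> \<in> space ?S"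
    then show "ennreal (of_bool (case_prod est (?run \<omega>) \<noteq> fst \<omega>)) \<le> indicator E \<omega> + indicator T \<omega>"
      by (cases rule: run_cases[of N f stop "fst \<omega>" "snd \<omega>"])
        (auto simp: E_def T_def indicator_def)
  qed
  also have "\<dots> = emeasure ?S E + emeasure ?S T"
    using E T by (subst nn_integral_add) auto
  also have "\<dots> = ennreal (measure ?S E + measure ?S T)"
    by (simp add: emeasure_eq_measure)
  finally have 1: "trunc_err f stop est n p N \<le> measure ?S E + measure ?S T"
    by (subst (asm) ennreal_le_iff) simp_all
  have "ennreal (N * measure ?S T) = (\<integral>\<^sup>+\<omega>. of_nat N * indicator T \<omega> \<partial>?S)"
    using T by (simp add: nn_integral_cmult_indicator emeasure_eq_measure ennreal_mult ennreal_of_nat_eq_real_of_nat)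
  also have "\<dots> \<le> exp_queries f stop n p"
    unfolding exp_queries_def
  proof (rule nn_integral_mono)
    fix \<omega>
    show "of_nat N * indicator T \<omega> \<le> ennreal_of_enat (stop_time f stop (fst \<omega>) (snd \<omega>))"
    proof (cases rule: run_cases[of N f stop "fst \<omega>" "snd \<omega>"])
      case running
      then have "ennreal_of_enat (enat N) \<le> ennreal_of_enat (stop_time f stop (fst \<omega>) (snd \<omega>))"
        by (simp only: ennreal_of_enat_le_iff less_imp_le)
      then show ?thesis by (simp add: indicator_def)
    qed (simp add: T_def indicator_def)
  qed
  also have "\<dots> = ennreal (enn2real (exp_queries f stop n p))" using fin by simp
  finally have "N * measure ?S T \<le> enn2real (exp_queries f stop n p)" by simp
  then have "measure ?S T \<le> enn2real (exp_queries f stop n p) / N"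
    using N by (simp add: field_simps)
  with 1 show ?thesis unfolding PeE by linarith
qed

section \<open>Removing the truncation and fixing the parameters\<close>

lemma sum_run_mean_uniform:
  fixes \<alpha> \<beta> :: real
  assumes "n \<ge> 1"
  shows "(\<Sum>l\<in>{1..n}. 1 / n * run_mean f stop p (\<lambda>h l. length (fst h) + \<alpha> * of_bool (case_prod est h \<noteq> l) + \<beta>) N 0 ([], []) l)
    = trunc_queries f stop n p N + \<alpha> * trunc_err f stop est n p N + \<beta>"
  using assms unfolding run_mean_affine trunc_queries_def trunc_err_def
  by (simp add: distrib_left sum.distrib sum_distrib_left add_divide_distrib mult.left_commute)

lemma entropy_pot_uniform:
  assumes "n \<ge> 1"
  shows "entropy_pot {1..n} (\<lambda>_. 1 / real n) = log 2 n"
  using assms by (simp add: entropy_pot_def log_divide)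

text \<open>The truncation depth is free. It is taken so large that cutting off adds at most
  \<open>Pe / log 2 n\<close> to the error; for the coefficients \<open>\<alpha>\<close> used below,
  of order at most \<open>log 2 n + 1 / Pe\<close>, this loses only O(1).\<close>

lemma exp_queries_ge:
  fixes \<alpha> \<beta> :: real
  assumes p: "0 \<le> p" "p < 1/2" and n: "n \<ge> 2" and Pe: "err_prob f stop est n p = Pe" "Pe > 0"
    and fin: "exp_queries f stop n p < \<infinity>" and \<alpha>: "0 \<le> \<alpha>"
    and bound: "\<And>N. c \<le> (\<Sum>l\<in>{1..n}. 1 / n * run_mean f stop p
       (\<lambda>h l. length (fst h) + \<alpha> * of_bool (case_prod est h \<noteq> l) + \<beta>) N 0 ([], []) l)"
  shows "c - \<alpha> * (Pe + Pe / log 2 n) - \<beta> \<le> enn2real (exp_queries f stop n p)"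
proof -
  define X where "X = enn2real (exp_queries f stop n p)"
  have X: "0 \<le> X" "exp_queries f stop n p = ennreal X" using fin by (simp_all add: X_def)
  have L: "0 < log 2 n" using n by simp
  obtain N :: nat where "X / (Pe / log 2 n) < N" using reals_Archimedean2 by blast
  then have N': "X / (Pe / log 2 n) < Suc N" by simp
  then have "X < Suc N * (Pe / log 2 n)" using Pe L by (subst (asm) pos_divide_less_eq) auto
  then have "X / Suc N \<le> Pe / log 2 n" by (subst pos_divide_le_eq) (auto simp: mult.commute)
  then have "trunc_err f stop est n p (Suc N) \<le> Pe + Pe / log 2 n"
    using trunc_err_le[of p n f stop est "Suc N"] p n Pe fin by (simp add: X_def)
  then have "\<alpha> * trunc_err f stop est n p (Suc N) \<le> \<alpha> * (Pe + Pe / log 2 n)"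
    using \<alpha> by (rule mult_left_mono)
  moreover have "trunc_queries f stop n p (Suc N) \<le> X"
    using trunc_queries_le[of p n f stop "Suc N"] p n X by simp
  moreover have "c \<le> trunc_queries f stop n p (Suc N) + \<alpha> * trunc_err f stop est n p (Suc N) + \<beta>"
    using bound[of "Suc N"] n by (simp only: sum_run_mean_uniform)
  ultimately show ?thesis unfolding X_def by linarith
qed

lemma exp_queries_noiseless:
  assumes n: "n \<ge> 2" and est: "\<And>ys us. est ys us \<in> {1..n}"
    and Pe: "err_prob f stop est n 0 = Pe" "Pe > 0" and fin: "exp_queries f stop n 0 < \<infinity>"
  shows "log 2 n - Pe * log 2 n - (1 + 1 / ln 2) \<le> enn2real (exp_queries f stop n 0)"
proof -
  have Pe1: "Pe \<le> 1" using prob_space.prob_le_1[OF prob_space_search_space] Pe by (auto simp: err_prob_def)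
  have L: "0 < log 2 n" using n by simp
  have "log 2 n - log 2 n * (Pe + Pe / log 2 n) - 1 / ln 2 \<le> enn2real (exp_queries f stop n 0)"
  proof (rule exp_queries_ge[OF _ _ n Pe fin])
    fix N
    have "entropy_pot {1..n} (\<lambda>_. 1 / real n) + sum (\<lambda>_. 1 / real n) {1..n} * real 0 \<le>
      (\<Sum>l\<in>{1..n}. 1 / n * run_mean f stop 0
       (\<lambda>h l. length (fst h) + log 2 n * of_bool (case_prod est h \<noteq> l) + 1 / ln 2) N 0 ([], []) l)"
    proof (rule noiseless_potential_bound)
      show "case_prod est h \<in> {1..n}" for h using est by (cases h) auto
    qed (use n in simp_all)
    then show "log 2 n \<le> (\<Sum>l\<in>{1..n}. 1 / n * run_mean f stop 0
       (\<lambda>h l. length (fst h) + log 2 n * of_bool (case_prod est h \<noteq> l) + 1 / ln 2) N 0 ([], []) l)"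
      using entropy_pot_uniform[of n] n by simp
  qed (use L in auto)
  moreover have "log 2 n * (Pe + Pe / log 2 n) = Pe * log 2 n + Pe" using L by (simp add: field_simps)
  ultimately show ?thesis using Pe1 by linarith
qed

text \<open>The tangent point is \<open>t = Pe\<close> and the start is the uniform prior, of
  entropy \<open>log 2 n\<close>. In the constant, \<open>1/2 + 1 / ln 2\<close> and
  \<open>1 - log 2 p\<close> come from \<open>\<kappa>\<close>, \<open>1 / ln 2\<close> from
  \<open>\<beta>\<close>, and the remaining 1 and \<open>4 / ln 2\<close> from the error term and
  the truncation.\<close>

lemma exp_queries_noisy:
  assumes p: "0 < p" "p < 1/2" and n: "n \<ge> 2" and est: "\<And>ys us. est ys us \<in> {1..n}"
    and Pe: "err_prob f stop est n p = Pe" "Pe > 0" and fin: "exp_queries f stop n p < \<infinity>"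
  shows "log 2 n / (1 - H2 p) - log 2 Pe / Dkl p - log 2 (log 2 n) / Dkl p - Pe * log 2 n / (1 - H2 p)
     - ((3/2 + 1 / ln 2) / (1 - H2 p) + (1 + 5 / ln 2 - log 2 p) / Dkl p)
     \<le> enn2real (exp_queries f stop n p)"
proof -
  define b where "b = 1 / Dkl p"
  define c where "c = 1 / (1 - H2 p)"
  have C: "0 < 1 - H2 p" using H2_less_1[of p] p by simp
  have cb: "0 < b" "0 < c"
    using C capacity_le_Dkl[OF p] by (auto simp: b_def c_def)
  have Pe1: "Pe \<le> 1" using prob_space.prob_le_1[OF prob_space_search_space] Pe by (auto simp: err_prob_def)
  have L: "1 \<le> log 2 n" using n by (simp add: le_log_iff)
  define \<delta> where "\<delta> = 1 / (2 * log 2 n)"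
  define \<kappa> where "\<kappa> = (1/2 + 1 / ln 2) / (1 - H2 p) - log 2 (p * \<delta>) / Dkl p"
  define \<alpha> where "\<alpha> = log 2 n / (1 - H2 p) + (1 / (Pe * ln 2) - log 2 Pe) / Dkl p"
  define \<beta> where "\<beta> = \<kappa> + (1 / ln 2 + log 2 Pe) / Dkl p"
  have \<delta>0: "0 < \<delta>" "\<delta> \<le> 1/2" using L by (auto simp: \<delta>_def field_simps)
  have "log 2 \<delta> = - 1 - log 2 (log 2 n)"
    using L by (simp add: \<delta>_def log_divide log_mult)
  then have \<kappa>': "\<kappa> = (1/2 + 1 / ln 2) * c - (log 2 p - 1 - log 2 (log 2 n)) * b"
    using p \<delta>0 by (simp add: \<kappa>_def b_def c_def log_mult)
  have lPe: "log 2 Pe \<le> 0" using Pe Pe1 by simp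
  have "0 \<le> 1 / (Pe * ln 2)" using Pe(2) by simp
  then have nn: "0 \<le> 1 / (Pe * ln 2) - log 2 Pe" using lPe by linarith
  have "\<alpha> \<ge> 0"
    unfolding \<alpha>_def using cb L C nn
    by (intro add_nonneg_nonneg divide_nonneg_nonneg) (auto simp: b_def)
  have "log 2 n / (1 - H2 p) - \<alpha> * (Pe + Pe / log 2 n) - \<beta> \<le> enn2real (exp_queries f stop n p)"
  proof (rule exp_queries_ge[OF _ _ n Pe fin \<open>\<alpha> \<ge> 0\<close>])
    fix N
    have "entropy_pot {1..n} (\<lambda>_. 1 / real n) / (1 - H2 p) + sum (\<lambda>_. 1 / real n) {1..n} * real 0 \<le>
      (\<Sum>l\<in>{1..n}. 1 / n * run_mean f stop p
       (\<lambda>h l. length (fst h) + \<alpha> * of_bool (case_prod est h \<noteq> l) + \<beta>) N 0 ([], []) l)"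
    proof (rule noisy_potential_bound[OF p Pe(2) Pe1 _ _ _ _ _ _ refl])
      show "\<delta> = 1 / (2 * log 2 (real (card {1..n})))" by (simp add: \<delta>_def)
      show "\<alpha> = log 2 (real (card {1..n})) / (1 - H2 p) + (1 / (Pe * ln 2) - log 2 Pe) / Dkl p"
        by (simp add: \<alpha>_def)
      \<comment> \<open>The uniform prior has at least half of its mass outside any position, which
        covers \<open>p * \<delta>\<close>.\<close>
      have "p * \<delta> \<le> 1 * (1/2)" using p \<delta>0 by (intro mult_mono) auto
      moreover have "1 / real n \<le> 1/2" using n by (simp add: field_simps)
      ultimately have "p * \<delta> \<le> 1 - 1 / real n" by linarith
      then show "p * \<delta> * (\<Sum>_\<in>{1..n}. 1 / real n) \<le> (\<Sum>_\<in>{1..n}. 1 / real n) - 1 / real n"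
        using n by simp
      show "case_prod est h \<in> {1..n}" for h using est by (cases h) auto
    qed (use n in \<open>simp_all add: \<kappa>_def \<beta>_def\<close>)
    then show "log 2 n / (1 - H2 p) \<le> (\<Sum>l\<in>{1..n}. 1 / n * run_mean f stop p
       (\<lambda>h l. length (fst h) + \<alpha> * of_bool (case_prod est h \<noteq> l) + \<beta>) N 0 ([], []) l)"
      using entropy_pot_uniform[of n] n by simp
  qed (use p in auto)
  moreover have "\<alpha> * (Pe + Pe / log 2 n) \<le> c * (Pe * log 2 n) + c + 4 * b / ln 2"
  proof -
    define q where "q = Pe + Pe / log 2 n"
    have q: "q \<le> 2 * Pe" "0 \<le> q" using L Pe by (auto simp: q_def field_simps)
    have 1: "log 2 n * q = Pe * log 2 n + Pe" using L by (simp add: field_simps q_def)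
    \<comment> \<open>The steep part \<open>1 / (Pe * ln 2)\<close> of \<open>\<alpha>\<close> meets
      an error of at most \<open>2 * Pe\<close>, and \<open>- Pe * log 2 Pe\<close> is
      bounded.\<close>
    have "(1 / (Pe * ln 2) - log 2 Pe) * q \<le> (1 / (Pe * ln 2) - log 2 Pe) * (2 * Pe)"
      using q nn by (intro mult_left_mono)
    also have "\<dots> = 2 / ln 2 + 2 * (Pe * (log 2 1 - log 2 Pe))" using Pe by (simp add: field_simps)
    also have "Pe * (log 2 1 - log 2 Pe) \<le> (1 - Pe) / ln 2" using Pe by (intro mult_log_le) auto
    also have "\<dots> \<le> 1 / ln 2" using Pe by (simp add: divide_right_mono)
    finally have "(1 / (Pe * ln 2) - log 2 Pe) * q \<le> 4 / ln 2" by simp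
    then have 2: "b * ((1 / (Pe * ln 2) - log 2 Pe) * q) \<le> b * (4 / ln 2)"
      using cb by (intro mult_left_mono) simp_all
    have "\<alpha> = c * log 2 n + b * (1 / (Pe * ln 2) - log 2 Pe)"
      by (simp add: \<alpha>_def b_def c_def)
    then have "\<alpha> * q = c * (log 2 n * q) + b * ((1 / (Pe * ln 2) - log 2 Pe) * q)"
      by (simp only: distrib_right mult.assoc)
    also have "\<dots> \<le> c * (Pe * log 2 n) + c * 1 + b * (4 / ln 2)"
      unfolding 1 distrib_left using 2 cb Pe1 by (intro add_mono[OF _ 2] add_mono order_refl mult_left_mono) simp_all
    finally show ?thesis by (simp add: q_def mult.commute[of b])
  qed
  moreover have "\<beta> = \<kappa> + b / ln 2 + b * log 2 Pe" by (simp add: \<beta>_def b_def add_divide_distrib)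
  moreover have "x / (1 - H2 p) = c * x" "x / Dkl p = b * x" for x by (simp_all add: b_def c_def)
  ultimately show ?thesis unfolding \<kappa>' by (simp add: algebra_simps)
qed

theorem theorem8:
  fixes p :: real
  assumes "0 \<le> p" and "p < 1/2"
  shows "\<exists>C::real. \<forall>(n::nat) f stop est.
     (\<forall>k ys us. f k ys us \<in> {1..<n}) \<longrightarrow>
     (\<forall>ys us. est ys us \<in> {1..n}) \<longrightarrow>
     err_prob f stop est n p > 0 \<longrightarrow>
     (let Pe = err_prob f stop est n p in
       ereal (log 2 (real n) / (1 - H2 p) + log 2 (1 / Pe) / Dkl p
              - log 2 (log 2 (real n / Pe)) / Dkl p
              - Pe * log 2 (real n) / (1 - H2 p) - C)
       < enn2ereal (exp_queries f stop n p))"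
proof -
  \<comment> \<open>The final \<open>+ 1\<close> turns the non-strict bounds into a strict
    one.\<close>
  define C where "C = (if p = 0 then 1 + 1 / ln 2 
     else (3/2 + 1 / ln 2) / (1 - H2 p) + (1 + 5 / ln 2 - log 2 p) / Dkl p) + 1"
  have "ereal (log 2 (real n) / (1 - H2 p) + log 2 (1 / Pe) / Dkl p
              - log 2 (log 2 (real n / Pe)) / Dkl p
              - Pe * log 2 (real n) / (1 - H2 p) - C)
       < enn2ereal (exp_queries f stop n p)"
    if f: "\<forall>k ys us. f k ys us \<in> {1..<n}" and est: "\<forall>ys us. est ys us \<in> {1..n}"
      and Pe: "err_prob f stop est n p > 0" "err_prob f stop est n p = Pe" for n f stop est Pe
  proof (cases "exp_queries f stop n p = \<infinity>")
    case False
    then have fin: "exp_queries f stop n p < \<infinity>" by (simp add: less_top)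
    then have X: "enn2ereal (exp_queries f stop n p) = ereal (enn2real (exp_queries f stop n p))"
      by (cases "exp_queries f stop n p") (simp_all add: enn2ereal_ennreal)
    \<comment> \<open>A first query exists in \<open>{1..<n}\<close>, which forces
      \<open>n \<ge> 2\<close>.\<close>
    have "f 0 [] [] \<in> {1..<n}" using f by (elim allE)
    then have n: "n \<ge> 2" by simp
    have Pe0: "Pe > 0" using Pe by simp
    have Pe1: "Pe \<le> 1" using prob_space.prob_le_1[OF prob_space_search_space] Pe by (auto simp: err_prob_def)
    have est': "est ys us \<in> {1..n}" for ys us using est by (elim allE)
    have "log 2 (real n) / (1 - H2 p) + log 2 (1 / Pe) / Dkl p - log 2 (log 2 (real n / Pe)) / Dkl p
        - Pe * log 2 (real n) / (1 - H2 p) - C < enn2real (exp_queries f stop n p)"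
    proof (cases "p = 0")
      case True
      have "log 2 n - Pe * log 2 n - (1 + 1 / ln 2) \<le> enn2real (exp_queries f stop n p)"
        using exp_queries_noiseless[OF n est' Pe(2)[unfolded True] Pe0 fin[unfolded True]]
        unfolding True .
      \<comment> \<open>\<open>Dkl 0\<close> evaluates to 0 because \<open>1 / 0 = 0\<close> and
        \<open>ln 0 = 0\<close>. Division by it removes two terms of the bound, in agreement with a
        true divergence that is infinite.\<close>
      moreover have "C = 1 + 1 / ln 2 + 1" "H2 p = 0" "Dkl p = 0"
        by (simp_all add: True C_def H2_def Dkl_def log_def)
      ultimately show ?thesis by simp
    next
      case False
      then have p: "0 < p" "p < 1/2" using assms by auto
      have D: "Dkl p > 0" using capacity_le_Dkl[OF p] H2_less_1[of p] p by simp
      \<comment> \<open>Since \<open>Pe \<le> 1\<close>, having \<open>n / Pe\<close> in the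
        iterated logarithm only weakens the bound.\<close>
      have "log 2 n \<le> log 2 (n / Pe)"
        using Pe0 Pe1 n by (simp add: le_divide_eq mult_left_le)
      moreover have "0 < log 2 n" using n by simp
      ultimately have "log 2 (log 2 n) / Dkl p \<le> log 2 (log 2 (n / Pe)) / Dkl p"
        using D by (intro divide_right_mono) auto
      moreover have "log 2 (1 / Pe) / Dkl p = - (log 2 Pe / Dkl p)" using Pe0 by (simp add: log_divide)
      moreover have "C = (3/2 + 1 / ln 2) / (1 - H2 p) + (1 + 5 / ln 2 - log 2 p) / Dkl p + 1"
        using False by (simp add: C_def)
      ultimately show ?thesis
        using exp_queries_noisy[OF p n est' Pe(2) Pe0 fin] by linarith
    qed
    then show ?thesis unfolding X by (rule less_ereal.simps(1)[THEN iffD2])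
  qed simp
  note main = this[OF _ _ _ refl]
  show ?thesis unfolding Let_def by (intro exI[of _ C] allI impI, rule main)
qed

end
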